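(* Let $n,m\ge1$ and $1\le r\le n$ be integers, let $\lambda$ be a partition with at most $r$ parts, and let $\mu=(m,m,\dots,m)$ ($r$ parts). Then the sequence $f(\ell)=s_{\lambda+\ell\mu}(x_1,\dots,x_n)$, $\ell\ge0$, satisfies, for all but finitely many $\ell$, a linear recurrence with characteristic polynomial $\prod_{1\le i_1<i_2<\dots<i_r\le n}\bigl(t-(x_{i_1}x_{i_2}\cdots x_{i_r})^m\bigr)$.
   Context: $s_\nu(x_1,\dots,x_n)$ denotes the Schur polynomial of a partition $\nu$ in $n$ variables, viewed in the field $K=\mathbb Q(x_1,\dots,x_n)$. Partitions are added componentwise: $(\lambda+\ell\mu)_i=\lambda_i+\ell\mu_i$. A sequence $f:\mathbb N\to K$ satisfies a linear recurrence with characteristic polynomial $Q(t)=t^D-\alpha_1t^{D-1}+\dots+(-1)^D\alpha_D\in K[t]$ if $f(k+D)-\alpha_1f(k+D-1)+\dots+(-1)^D\alpha_Df(k)=0$ for the relevant $k$. *)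

theory Defs
  imports
    "HOL-Library.Poly_Mapping"
    "HOL-Library.Cardinality"
    "HOL-Library.FuncSet"
    "HOL-Library.Infinite_Set"
    "HOL-Computational_Algebra.Polynomial_Factorial"
begin

text \<open>
  The variables are indexed by a finite linearly ordered type \<open>'n\<close> with \<open>n = CARD('n)\<close> elements.
  A monomial is an exponent vector, a polynomial is a finitely supported map from monomials to
  \<open>rat\<close>, and \<open>'n ratfun\<close> is the field of rational functions over the rationals
  in the \<open>n\<close> variables.
\<close>

type_synonym 'n mpolyn = "('n \<Rightarrow>\<^sub>0 nat) \<Rightarrow>\<^sub>0 rat"

type_synonym 'n ratfun = "'n mpolyn fract"

definition var :: "'n::{finite,linorder} \<Rightarrow> 'n mpolyn" where
  "var i = Poly_Mapping.single (Poly_Mapping.single i 1) 1"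

text \<open>Partitions are weakly decreasing, eventually zero sequences; the largest part has index 0.\<close>

definition is_partition :: "(nat \<Rightarrow> nat) \<Rightarrow> bool" where
  "is_partition \<nu> \<longleftrightarrow> antimono \<nu> \<and> finite {i. \<nu> i \<noteq> 0}"

definition num_parts :: "(nat \<Rightarrow> nat) \<Rightarrow> nat" where
  "num_parts \<nu> = card {i. \<nu> i \<noteq> 0}"

definition rect_partition :: "nat \<Rightarrow> nat \<Rightarrow> nat \<Rightarrow> nat" where
  "rect_partition r m = (\<lambda>i. if i < r then m else 0)"

definition young_diagram :: "(nat \<Rightarrow> nat) \<Rightarrow> (nat \<times> nat) set" where
  "young_diagram \<nu> = {(i, j). j < \<nu> i}"

definition ssyt :: "(nat \<Rightarrow> nat) \<Rightarrow> (nat \<times> nat \<Rightarrow> 'n::{finite,linorder}) set" where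
  "ssyt \<nu> = {T \<in> young_diagram \<nu> \<rightarrow>\<^sub>E UNIV.
     (\<forall>i j. (i, Suc j) \<in> young_diagram \<nu> \<longrightarrow> T (i, j) \<le> T (i, Suc j)) \<and>
     (\<forall>i j. (Suc i, j) \<in> young_diagram \<nu> \<longrightarrow> T (i, j) < T (Suc i, j))}"

definition schur :: "(nat \<Rightarrow> nat) \<Rightarrow> 'n::{finite,linorder} mpolyn" where
  "schur \<nu> = (\<Sum>T\<in>ssyt \<nu>. \<Prod>c\<in>young_diagram \<nu>. var (T c))"

lemma finite_young_diagram:
  assumes "is_partition \<nu>"
  shows "finite (young_diagram \<nu>)"
proof (rule finite_subset)
  show "young_diagram \<nu> \<subseteq> {i. \<nu> i \<noteq> 0} \<times> {..<\<nu> 0}"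
    using assms by (auto simp: young_diagram_def is_partition_def
        dest: antimonoD[of \<nu> 0] intro: less_le_trans)
  show "finite ({i. \<nu> i \<noteq> 0} \<times> {..<\<nu> 0})"
    using assms by (simp add: is_partition_def)
qed

lemma finite_ssyt:
  assumes "is_partition \<nu>"
  shows "finite (ssyt \<nu> :: (nat \<times> nat \<Rightarrow> 'n::{finite,linorder}) set)"
proof (rule finite_subset)
  show "ssyt \<nu> \<subseteq> (young_diagram \<nu> \<rightarrow>\<^sub>E (UNIV :: 'n set))"
    by (auto simp: ssyt_def)
  show "finite (young_diagram \<nu> \<rightarrow>\<^sub>E (UNIV :: 'n set))"
    by (intro finite_PiE finite_young_diagram assms) simp
qed

text \<open>
  For monic \<open>Q\<close> of degree \<open>D\<close>, written \<open>t^D - \<alpha>\<^sub>1 t^(D-1) + \<dots> + (-1)^D \<alpha>\<^sub>D\<close>, the coefficient of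
  \<open>t^(D-j)\<close> is \<open>(-1)^j \<alpha>\<^sub>j\<close>, so the sum below is
  \<open>f (k+D) - \<alpha>\<^sub>1 f (k+D-1) + \<dots> + (-1)^D \<alpha>\<^sub>D f k\<close>.
\<close>

definition recurrence_at :: "'a::field poly \<Rightarrow> (nat \<Rightarrow> 'a) \<Rightarrow> nat \<Rightarrow> bool" where
  "recurrence_at Q f k \<longleftrightarrow> lead_coeff Q = 1 \<and> (\<Sum>i\<le>degree Q. coeff Q i * f (k + i)) = 0"

end

theory Submission
  imports Defs "Jordan_Normal_Form.Determinant"
begin

text \<open>
  By induction on the number of variables, the tableau sum times the Vandermonde determinant is the
  alternant \<open>det (x\<^sub>i ^ (\<nu>\<^sub>j + n - 1 - j))\<close>: deleting the cells that contain the largest letter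
  leaves a tableau of interlacing shape, and clearing the last column of the alternant by row
  operations produces the same sum over interlacing shapes. Expanding the alternant of
  \<open>\<lambda> + \<ell> \<mu>\<close> over permutations \<open>p\<close> gives an exponential sum in \<open>\<ell>\<close> whose bases are the
  \<open>(x\<^bsub>p 0\<^esub> \<cdots> x\<^bsub>p (r - 1)\<^esub>) ^ m\<close>, which are roots of \<open>Q\<close>. In particular the recurrence holds for
  all \<open>\<ell>\<close>.
\<close>

section \<open>Alternants and their branching rule\<close>

text \<open>These are the shapes that remain when the cells with the largest of \<open>k + 1\<close>
  letters are deleted from shape \<open>\<nu>\<close>. Entries from index \<open>k\<close> on are
  pinned to 0, so that only finitely many functions qualify.\<close>

definition interlacing :: "nat \<Rightarrow> (nat \<Rightarrow> nat) \<Rightarrow> (nat \<Rightarrow> nat) set" where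
  "interlacing k \<nu> = {\<kappa>. (\<forall>j<k. \<nu> (Suc j) \<le> \<kappa> j \<and> \<kappa> j \<le> \<nu> j) \<and> (\<forall>j\<ge>k. \<kappa> j = 0)}"

text \<open>For \<open>\<nu> = 0\<close> this is a Vandermonde determinant. Rows belong to parts and
  columns to variables, so a row operation combines neighbouring parts in all variables at
  once.\<close>

definition alternant :: "(nat \<Rightarrow> 'b::comm_ring_1) \<Rightarrow> nat \<Rightarrow> (nat \<Rightarrow> nat) \<Rightarrow> 'b" where
  "alternant x k \<nu> = det (mat k k (\<lambda>(j, i). x i ^ (\<nu> j + (k - 1 - j))))"

lemma det_mat_expand:
  "det (mat k k (\<lambda>(j, i). F j i)) =
    (\<Sum>p | p permutes {0..<k}. signof p * (\<Prod>j=0..<k. F j (p j) :: 'b::comm_ring_1))"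
proof -
  have "p j < k" if "p permutes {0..<k}" "j < k" for p j
    using permutes_in_image[OF that(1), of j] that(2) by simp
  then show ?thesis
    by (subst det_def'[of _ k]) (auto intro!: sum.cong prod.cong)
qed

lemma alternant_expand:
  "alternant x k \<nu> =
    (\<Sum>p | p permutes {0..<k}. signof p * (\<Prod>j=0..<k. x (p j) ^ (\<nu> j + (k - 1 - j))))"
  unfolding alternant_def by (rule det_mat_expand)

text \<open>Only the default value outside \<open>{0..<k}\<close> changes: \<open>undefined\<close>
  for \<open>PiE\<close>, 0 for shapes.\<close>

lemma bij_betw_PiE_interlacing:
  "bij_betw (\<lambda>\<kappa> j. if j < k then \<kappa> j else 0)
    (PiE {0..<k} (\<lambda>j. {\<nu> (Suc j)..\<nu> j})) (interlacing k \<nu>)"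
  by (rule bij_betw_byWitness[where f' = "\<lambda>\<kappa>. restrict \<kappa> {0..<k}"])
    (auto simp: interlacing_def PiE_iff extensional_def fun_eq_iff restrict_def)

lemma finite_interlacing: "finite (interlacing k \<nu>)"
  using bij_betw_finite[OF bij_betw_PiE_interlacing[of k \<nu>]] by (simp add: finite_PiE)

text \<open>The bounds on \<open>\<kappa> j\<close> for different \<open>j\<close> are independent
  of each other, so choosing one summand per factor is the same as choosing an interlacing
  shape.\<close>

lemma prod_sum_interlacing:
  fixes g :: "nat \<Rightarrow> nat \<Rightarrow> 'b::comm_ring_1"
  shows "(\<Prod>j=0..<k. \<Sum>a=\<nu> (Suc j)..\<nu> j. g j a) = (\<Sum>\<kappa>\<in>interlacing k \<nu>. \<Prod>j=0..<k. g j (\<kappa> j))"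
proof -
  have "(\<Prod>j=0..<k. \<Sum>a=\<nu> (Suc j)..\<nu> j. g j a)
      = (\<Sum>\<kappa>\<in>PiE {0..<k} (\<lambda>j. {\<nu> (Suc j)..\<nu> j}). \<Prod>j=0..<k. g j (\<kappa> j))"
    by (rule prod_sum_PiE) auto
  also have "\<dots> = (\<Sum>\<kappa>\<in>PiE {0..<k} (\<lambda>j. {\<nu> (Suc j)..\<nu> j}). \<Prod>j=0..<k. g j (if j < k then \<kappa> j else 0))"
    by simp
  also have "\<dots> = (\<Sum>\<kappa>\<in>interlacing k \<nu>. \<Prod>j=0..<k. g j (\<kappa> j))"
    by (rule sum.reindex_bij_betw[OF bij_betw_PiE_interlacing, of "\<lambda>\<kappa>. \<Prod>j=0..<k. g j (\<kappa> j)"])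
  finally show ?thesis .
qed

text \<open>A telescoping geometric sum. Its range of exponents \<open>b..a\<close> later becomes
  the range \<open>\<nu> (Suc j)..\<nu> j\<close> of a part of an interlacing shape.\<close>

lemma diff_mult_sum_power:
  fixes u v :: "'b::comm_ring_1"
  assumes "b \<le> a"
  shows "(u - v) * (\<Sum>c=b..a. u ^ c * v ^ (a - c)) = u ^ Suc a - u ^ b * v ^ (Suc a - b)"
  using assms
proof (induction a rule: dec_induct)
  case base
  show ?case by (simp add: algebra_simps)
next
  case (step a)
  have "(\<Sum>c=b..Suc a. u ^ c * v ^ (Suc a - c)) = v * (\<Sum>c=b..a. u ^ c * v ^ (a - c)) + u ^ Suc a"
    using step.hyps by (simp add: sum_distrib_left Suc_diff_le algebra_simps)
  then have "(u - v) * (\<Sum>c=b..Suc a. u ^ c * v ^ (Suc a - c))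
      = v * (u ^ Suc a - u ^ b * v ^ (Suc a - b)) + (u - v) * u ^ Suc a"
    by (simp only: step.IH[symmetric]) (simp only: algebra_simps)
  also have "\<dots> = u ^ Suc (Suc a) - u ^ b * v ^ (Suc (Suc a) - b)"
    using step.hyps by (simp add: Suc_diff_le algebra_simps)
  finally show ?case .
qed

text \<open>In column \<open>k\<close>, rows \<open>j\<close> and \<open>Suc j\<close> differ
  exactly by the factor \<open>x k ^ Suc (\<nu> j - \<nu> (Suc j))\<close>. Subtracting that
  multiple of each next row leaves only the bottom entry of this column, and Laplace expansion
  finishes.\<close>

lemma alternant_eliminate_last:
  fixes x :: "nat \<Rightarrow> 'b::comm_ring_1"
  assumes mono: "\<And>j. j < k \<Longrightarrow> \<nu> (Suc j) \<le> \<nu> j"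
  shows "alternant x (Suc k) \<nu> = x k ^ \<nu> k * det (mat k k (\<lambda>(j, i).
    x i ^ (\<nu> j + (k - j)) - x k ^ Suc (\<nu> j - \<nu> (Suc j)) * x i ^ (\<nu> (Suc j) + (k - Suc j))))"
proof -
  let ?K = "Suc k"
  let ?g = "\<lambda>j i. x i ^ (\<nu> j + (k - j)) - x k ^ Suc (\<nu> j - \<nu> (Suc j)) * x i ^ (\<nu> (Suc j) + (k - Suc j))"
  define A where "A = mat ?K ?K (\<lambda>(j, i). x i ^ (\<nu> j + (k - j)))"
  \<comment> \<open>Multiplying by this unitriangular matrix from the left performs all row
    operations simultaneously, each with the original next row.\<close>
  define U where "U = mat ?K ?K (\<lambda>(i, j). if j = i then 1 else
    if j = Suc i then - (x k ^ Suc (\<nu> i - \<nu> j)) else 0)"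
  define B where "B = mat ?K ?K (\<lambda>(j, i). if j < k then ?g j i else x i ^ \<nu> k)"
  have carr: "A \<in> carrier_mat ?K ?K" "U \<in> carrier_mat ?K ?K" "B \<in> carrier_mat ?K ?K"
    by (auto simp: A_def U_def B_def)
  have "det U = prod_list (diag_mat U)"
    by (rule det_upper_triangular[OF _ carr(2)]) (auto simp: U_def)
  also have "diag_mat U = replicate ?K 1"
    by (intro nth_equalityI) (auto simp: diag_mat_def U_def simp del: upt_Suc replicate_Suc)
  also have "prod_list \<dots> = 1"
    by (simp only: prod_list_replicate power_one)
  finally have "det U = 1" .
  have UA: "U * A = B"
  proof (rule eq_matI)
    fix j i assume "j < dim_row B" "i < dim_col B"
    then have ji: "j < ?K" "i < ?K" by (auto simp: B_def)
    have "(U * A) $$ (j, i) = (\<Sum>t = 0..<?K. U $$ (j, t) * A $$ (t, i))"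
      using ji by (simp add: scalar_prod_def U_def A_def)
    \<comment> \<open>A row of \<open>U\<close> has at most two nonzero entries. For
      \<open>j = k\<close> the index \<open>Suc j\<close> is out of range, so the last row stays
      unchanged.\<close>
    also have "\<dots> = (\<Sum>t = 0..<?K. (if t = j then A $$ (j, i) else 0) +
        (if t = Suc j then - (x k ^ Suc (\<nu> j - \<nu> (Suc j))) * A $$ (Suc j, i) else 0))"
      using ji by (intro sum.cong) (auto simp: U_def)
    also have "\<dots> = B $$ (j, i)"
      using ji by (auto simp: sum.distrib A_def B_def not_less less_Suc_eq)
    finally show "(U * A) $$ (j, i) = B $$ (j, i)" .
  qed (auto simp: U_def A_def B_def)
  have zero: "?g j k = 0" if "j < k" for j
  proof -
    have "Suc (\<nu> j - \<nu> (Suc j)) + (\<nu> (Suc j) + (k - Suc j)) = \<nu> j + (k - j)"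
      using mono[OF that] that by simp
    then show ?thesis by (simp only: power_add[symmetric]) simp
  qed
  have "alternant x ?K \<nu> = det A"
    by (simp add: alternant_def A_def)
  also have "\<dots> = det (U * A)"
    by (simp add: det_mult[OF carr(2,1)] \<open>det U = 1\<close>)
  also have "\<dots> = (\<Sum>j<?K. B $$ (j, k) * cofactor B j k)"
    unfolding UA by (rule laplace_expansion_column[OF carr(3)]) simp
  also have "\<dots> = B $$ (k, k) * cofactor B k k"
  proof -
    have "B $$ (j, k) = 0" if "j < k" for j
      using zero[OF that] that by (simp add: B_def)
    then show ?thesis by simp
  qed
  also have "mat_delete B k k = mat k k (\<lambda>(j, i). ?g j i)"
    by (rule eq_matI) (auto simp: mat_delete_def B_def)
  then have "cofactor B k k = det (mat k k (\<lambda>(j, i). ?g j i))"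
    by (simp add: cofactor_def)
  finally show ?thesis
    by (simp add: B_def)
qed

text \<open>After the elimination, each entry in column \<open>i\<close> is \<open>x i - x k\<close>
  times a geometric sum over the admissible values of one part. The linear factors come out of the
  columns, and multiplying out the geometric sums row by row leaves one smaller alternant per
  interlacing shape.\<close>

lemma alternant_Suc:
  fixes x :: "nat \<Rightarrow> 'b::comm_ring_1"
  assumes mono: "\<And>j. j < k \<Longrightarrow> \<nu> (Suc j) \<le> \<nu> j"
  shows "alternant x (Suc k) \<nu> = (\<Prod>i=0..<k. x i - x k) *
    (\<Sum>\<kappa>\<in>interlacing k \<nu>. x k ^ (\<nu> k + (\<Sum>j=0..<k. \<nu> j - \<kappa> j)) * alternant x k \<kappa>)"
proof -
  let ?P = "\<Prod>i=0..<k. x i - x k"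
  let ?s = "\<lambda>j a. x k ^ (\<nu> j - a)"
  have entry: "x i ^ (\<nu> j + (k - j)) - x k ^ Suc (\<nu> j - \<nu> (Suc j)) * x i ^ (\<nu> (Suc j) + (k - Suc j))
      = (x i - x k) * (\<Sum>a=\<nu> (Suc j)..\<nu> j. x i ^ (a + (k - 1 - j)) * ?s j a)" if "j < k" for i j
  proof -
    have "(x i - x k) * (\<Sum>a=\<nu> (Suc j)..\<nu> j. x i ^ (a + (k - 1 - j)) * ?s j a)
        = x i ^ (k - 1 - j) * ((x i - x k) * (\<Sum>a=\<nu> (Suc j)..\<nu> j. x i ^ a * ?s j a))"
      by (simp add: sum_distrib_left power_add algebra_simps)
    also have "\<dots> = x i ^ (k - 1 - j) *
        (x i ^ Suc (\<nu> j) - x i ^ \<nu> (Suc j) * x k ^ (Suc (\<nu> j) - \<nu> (Suc j)))"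
      by (simp only: diff_mult_sum_power[OF mono[OF that]])
    also have "\<dots> = x i ^ (k - 1 - j + Suc (\<nu> j)) -
        x k ^ (Suc (\<nu> j) - \<nu> (Suc j)) * x i ^ (\<nu> (Suc j) + (k - 1 - j))"
      by (simp only: power_add algebra_simps)
    also have "k - 1 - j + Suc (\<nu> j) = \<nu> j + (k - j)"
      using that by simp
    also have "Suc (\<nu> j) - \<nu> (Suc j) = Suc (\<nu> j - \<nu> (Suc j))"
      using mono[OF that] by simp
    finally show ?thesis by simp
  qed
  \<comment> \<open>A permutation meets every column once, so the linear factors contribute the same
    product to each term of the determinant.\<close>
  have perm: "(\<Prod>j=0..<k. x (p j) - x k) = ?P" if "p permutes {0..<k}" for p
    using prod.permute[OF that, of "\<lambda>i. x i - x k"] by (simp add: o_def)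
  have "det (mat k k (\<lambda>(j, i).
      x i ^ (\<nu> j + (k - j)) - x k ^ Suc (\<nu> j - \<nu> (Suc j)) * x i ^ (\<nu> (Suc j) + (k - Suc j))))
    = (\<Sum>p | p permutes {0..<k}. signof p * (\<Prod>j=0..<k.
        (x (p j) - x k) * (\<Sum>a=\<nu> (Suc j)..\<nu> j. x (p j) ^ (a + (k - 1 - j)) * ?s j a)))"
    unfolding det_mat_expand by (intro sum.cong prod.cong arg_cong2[where f = "(*)"] refl entry) auto
  also have "\<dots> = (\<Sum>p | p permutes {0..<k}. signof p * (?P *
      (\<Sum>\<kappa>\<in>interlacing k \<nu>. \<Prod>j=0..<k. x (p j) ^ (\<kappa> j + (k - 1 - j)) * ?s j (\<kappa> j))))"
    by (intro sum.cong refl, subst prod.distrib) (simp only: mem_Collect_eq perm prod_sum_interlacing[where \<nu> = \<nu>])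
  also have "\<dots> = ?P * (\<Sum>p | p permutes {0..<k}. \<Sum>\<kappa>\<in>interlacing k \<nu>.
      (\<Prod>j=0..<k. ?s j (\<kappa> j)) * (signof p * (\<Prod>j=0..<k. x (p j) ^ (\<kappa> j + (k - 1 - j)))))"
    by (simp add: prod.distrib sum_distrib_left mult_ac)
  \<comment> \<open>With the sums exchanged, the sum over permutations for a fixed shape is again an
    alternant.\<close>
  also have "\<dots> = ?P * (\<Sum>\<kappa>\<in>interlacing k \<nu>. (\<Prod>j=0..<k. ?s j (\<kappa> j)) * alternant x k \<kappa>)"
    by (subst sum.swap) (simp add: alternant_expand sum_distrib_left)
  finally show ?thesis
    by (simp add: alternant_eliminate_last[of k \<nu>, OF mono] power_add power_sum sum_distrib_left mult_ac)
qed


section \<open>Interlacing shapes and the Vandermonde determinant\<close>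

lemma young_diagram_interlacing:
  assumes "\<kappa> \<in> interlacing k \<nu>"
  shows "young_diagram \<kappa> = Sigma {0..<k} (\<lambda>i. {..<\<kappa> i})"
proof -
  have "i < k" if "j < \<kappa> i" for i j
    using that assms by (cases "i < k") (auto simp: interlacing_def)
  then show ?thesis by (auto simp: young_diagram_def)
qed

text \<open>The part \<open>\<nu> (Suc j)\<close> lies between \<open>\<kappa> (Suc j)\<close> and
  \<open>\<kappa> j\<close>. This lets an induction continue with \<open>\<kappa>\<close>.\<close>

lemma antimono_interlacing:
  assumes "\<kappa> \<in> interlacing k \<nu>"
  shows "antimono \<kappa>"
  unfolding antimono_iff_le_Suc
proof
  fix j
  show "\<kappa> (Suc j) \<le> \<kappa> j"
    using assms le_trans[of "\<kappa> (Suc j)" "\<nu> (Suc j)" "\<kappa> j"]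
    by (cases "Suc j < k") (auto simp: interlacing_def)
qed

lemma interlacing_0: "interlacing k (\<lambda>_. 0) = {\<lambda>_. 0}"
  by (auto simp: interlacing_def fun_eq_iff) (meson not_le)

text \<open>The branching rule has a single term here, since only the empty shape interlaces with
  the empty shape.\<close>

lemma alternant_0_Suc:
  "alternant x (Suc k) (\<lambda>_. 0) = (\<Prod>i=0..<k. x i - x k) * alternant x k (\<lambda>_. 0)"
  using alternant_Suc[of k "\<lambda>_. 0" x] by (simp add: interlacing_0)

lemma alternant_0_nonzero:
  fixes x :: "nat \<Rightarrow> 'b::idom"
  assumes "inj_on x {..<k}"
  shows "alternant x k (\<lambda>_. 0) \<noteq> 0"
  using assms
proof (induction k)
  case 0
  show ?case by (simp add: alternant_def)
next
  case (Suc k)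
  have "inj_on x {..<k}"
    using Suc.prems by (rule inj_on_subset) auto
  moreover have "x i \<noteq> x k" if "i < k" for i
    using inj_onD[OF Suc.prems, of i k] that by auto
  ultimately show ?case
    using Suc.IH by (auto simp: alternant_0_Suc)
qed

section \<open>Tableaux over an initial segment of the alphabet\<close>

text \<open>In \<open>ssyt\<close> the alphabet is a whole type. Here it consists of the first
  \<open>k\<close> letters of an enumeration, so that it can shrink in an induction on
  \<open>k\<close>.\<close>

definition tableaux :: "(nat \<Rightarrow> 'a::linorder) \<Rightarrow> nat \<Rightarrow> (nat \<Rightarrow> nat) \<Rightarrow> (nat \<times> nat \<Rightarrow> 'a) set" where
  "tableaux e k \<nu> = {T \<in> young_diagram \<nu> \<rightarrow>\<^sub>E e ` {..<k}.
     (\<forall>i j. (i, Suc j) \<in> young_diagram \<nu> \<longrightarrow> T (i, j) \<le> T (i, Suc j)) \<and>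
     (\<forall>i j. (Suc i, j) \<in> young_diagram \<nu> \<longrightarrow> T (i, j) < T (Suc i, j))}"

definition tableaux_sum ::
  "(nat \<Rightarrow> 'a::linorder) \<Rightarrow> ('a \<Rightarrow> 'b::comm_ring_1) \<Rightarrow> nat \<Rightarrow> (nat \<Rightarrow> nat) \<Rightarrow> 'b" where
  "tableaux_sum e w k \<nu> = (\<Sum>T\<in>tableaux e k \<nu>. \<Prod>c\<in>young_diagram \<nu>. w (T c))"

lemma tableaux_entry_mem: "T \<in> tableaux e k \<nu> \<Longrightarrow> c \<in> young_diagram \<nu> \<Longrightarrow> T c \<in> e ` {..<k}"
  by (auto simp: tableaux_def)

lemma finite_tableaux:
  assumes "finite (young_diagram \<kappa>)"
  shows "finite (tableaux e j \<kappa>)"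
  by (rule finite_subset[of _ "young_diagram \<kappa> \<rightarrow>\<^sub>E e ` {..<j}"])
    (auto simp: tableaux_def intro!: finite_PiE assms)

lemma tableaux_row_mono:
  assumes "T \<in> tableaux e k \<nu>" "j \<le> j'" "j' < \<nu> i"
  shows "T (i, j) \<le> T (i, j')"
  using assms(2,3)
proof (induction j' rule: dec_induct)
  case (step j')
  then have "T (i, j) \<le> T (i, j')" by simp
  also have "\<dots> \<le> T (i, Suc j')"
    using step assms(1) by (auto simp: tableaux_def young_diagram_def)
  finally show ?case .
qed simp

text \<open>Strict increase down a column raises the index of the letter by at least one per row.
  With \<open>k + 1\<close> letters, row \<open>k\<close> can therefore contain only the largest
  one.\<close>

lemma tableaux_entry_ge_row:
  assumes T: "T \<in> tableaux e k \<nu>" and e: "strict_mono_on {..<k} e" and \<nu>: "antimono \<nu>"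
    and "j < \<nu> i"
  shows "\<exists>a<k. i \<le> a \<and> T (i, j) = e a"
  using assms(4)
proof (induction i)
  case 0
  have "T (0, j) \<in> e ` {..<k}"
    using T 0 by (auto simp: tableaux_def young_diagram_def)
  then show ?case by auto
next
  case (Suc i)
  have "j < \<nu> i"
    using Suc.prems antimonoD[OF \<nu>, of i "Suc i"] by simp
  then obtain a where a: "a < k" "i \<le> a" "T (i, j) = e a"
    using Suc.IH by blast
  have "T (Suc i, j) \<in> e ` {..<k}"
    using T Suc.prems by (auto simp: tableaux_def young_diagram_def)
  then obtain b where b: "b < k" "T (Suc i, j) = e b" by auto
  have "T (i, j) < T (Suc i, j)"
    using T Suc.prems by (simp add: tableaux_def young_diagram_def)
  then have "e a < e b"
    by (simp add: a b)
  then have "a < b"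
    using strict_mono_on_less[OF e] a(1) b(1) by simp
  then show ?case using a b by auto
qed

text \<open>In a row of a tableau with largest letter \<open>z\<close>, the cells not containing \<open>z\<close> are an initial segment.\<close>

definition inner_shape :: "'a \<Rightarrow> (nat \<Rightarrow> nat) \<Rightarrow> (nat \<times> nat \<Rightarrow> 'a) \<Rightarrow> nat \<Rightarrow> nat" where
  "inner_shape z \<nu> T i = (LEAST j. j \<ge> \<nu> i \<or> T (i, j) = z)"

lemma inner_shape_le: "inner_shape z \<nu> T i \<le> \<nu> i"
  unfolding inner_shape_def by (rule Least_le) simp

lemma entry_ne_if_less_inner_shape: "j < inner_shape z \<nu> T i \<Longrightarrow> T (i, j) \<noteq> z"
  unfolding inner_shape_def by (auto dest: not_less_Least)

lemma entry_at_inner_shape: "inner_shape z \<nu> T i < \<nu> i \<Longrightarrow> T (i, inner_shape z \<nu> T i) = z"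
  using LeastI[of "\<lambda>j. j \<ge> \<nu> i \<or> T (i, j) = z" "\<nu> i"]
  unfolding inner_shape_def by auto

text \<open>The inverse of deleting the letter \<open>z\<close>: the skew strip between the two
  shapes is filled with \<open>z\<close>. The value \<open>undefined\<close> elsewhere is the one
  required by the extensional function space in \<open>tableaux\<close>.\<close>

definition extend_tableau ::
  "'a \<Rightarrow> (nat \<Rightarrow> nat) \<Rightarrow> (nat \<Rightarrow> nat) \<Rightarrow> (nat \<times> nat \<Rightarrow> 'a) \<Rightarrow> nat \<times> nat \<Rightarrow> 'a" where
  "extend_tableau z \<nu> \<kappa> T c = (if c \<in> young_diagram \<kappa> then T c
     else if c \<in> young_diagram \<nu> then z else undefined)"

section \<open>Deleting and reinserting the largest letter\<close>

context
  fixes e :: "nat \<Rightarrow> 'a::linorder" and k :: nat and \<nu> :: "nat \<Rightarrow> nat"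
  assumes e: "strict_mono_on {..<Suc k} e" and \<nu>: "antimono \<nu>" and \<nu>0: "\<And>i. i > k \<Longrightarrow> \<nu> i = 0"
begin

lemma entry_le_last:
  assumes "T \<in> tableaux e (Suc k) \<nu>" "j < \<nu> i"
  shows "T (i, j) \<le> e k"
proof -
  have "T (i, j) \<in> e ` {..<Suc k}"
    using assms by (auto simp: tableaux_def young_diagram_def)
  then show ?thesis
    using strict_mono_on_leD[OF e] by auto
qed

text \<open>Rows increase weakly and \<open>e k\<close> is the largest letter, so a row that has
  reached it stays constant.\<close>

lemma entry_eq_last_iff:
  assumes "T \<in> tableaux e (Suc k) \<nu>" "j < \<nu> i"
  shows "T (i, j) = e k \<longleftrightarrow> inner_shape (e k) \<nu> T i \<le> j"
proof
  assume "inner_shape (e k) \<nu> T i \<le> j"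
  then have "T (i, inner_shape (e k) \<nu> T i) \<le> T (i, j)"
    using assms by (intro tableaux_row_mono[OF assms(1)]) auto
  moreover have "T (i, inner_shape (e k) \<nu> T i) = e k"
    using \<open>inner_shape (e k) \<nu> T i \<le> j\<close> assms(2) by (intro entry_at_inner_shape) simp
  ultimately show "T (i, j) = e k"
    using entry_le_last[OF assms] by simp
qed (use entry_ne_if_less_inner_shape[of j "e k" \<nu> T i] in force)

text \<open>The cells with the largest letter form a horizontal strip: no two of them are vertically
  adjacent. This is the lower bound \<open>\<nu> (Suc i)\<close> on the inner shape.\<close>

lemma inner_shape_interlacing:
  assumes T: "T \<in> tableaux e (Suc k) \<nu>"
  shows "inner_shape (e k) \<nu> T \<in> interlacing k \<nu>"
proof -
  let ?\<kappa> = "inner_shape (e k) \<nu> T"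
  have "\<nu> (Suc i) \<le> ?\<kappa> i" for i
  \<comment> \<open>Otherwise the first \<open>e k\<close> in row \<open>i\<close> would have a cell
    below it, whose entry would have to exceed the largest letter.\<close>
  proof (rule ccontr)
    assume "\<not> \<nu> (Suc i) \<le> ?\<kappa> i"
    then have *: "?\<kappa> i < \<nu> (Suc i)" by simp
    then have **: "?\<kappa> i < \<nu> i"
      using antimonoD[OF \<nu>, of i "Suc i"] by simp
    have "T (i, ?\<kappa> i) < T (Suc i, ?\<kappa> i)"
      using T * by (auto simp: tableaux_def young_diagram_def)
    also have "\<dots> \<le> e k"
      using T * by (rule entry_le_last)
    finally show False
      using entry_at_inner_shape[OF **] by simp
  qed
  moreover have "?\<kappa> i = 0" if "i \<ge> k" for i
  proof (cases "\<nu> i = 0")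
    case True
    then show ?thesis using inner_shape_le[of "e k" \<nu> T i] by simp
  next
    case False
    then have "i = k" using \<nu>0[of i] that by (cases "i = k") auto
    then obtain a where "a < Suc k" "i \<le> a" "T (i, 0) = e a"
      using tableaux_entry_ge_row[OF T e \<nu>, of 0 i] False by auto
    then have "T (i, 0) = e k" using \<open>i = k\<close> by (simp add: less_Suc_eq)
    then show ?thesis
      using entry_eq_last_iff[OF T, of 0 i] False by simp
  qed
  ultimately show ?thesis
    using inner_shape_le by (auto simp: interlacing_def)
qed

lemma young_diagram_interlacing_subset:
  assumes "\<kappa> \<in> interlacing k \<nu>"
  shows "young_diagram \<kappa> \<subseteq> young_diagram \<nu>"
proof -
  have "\<kappa> i \<le> \<nu> i" for i
    using assms by (cases "i < k") (auto simp: interlacing_def)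
  then show ?thesis
    by (auto simp: young_diagram_def intro: less_le_trans)
qed

text \<open>The cells without the largest letter are closed under moving left and up, so the row and
  column conditions are inherited.\<close>

lemma restrict_tableau:
  assumes T: "T \<in> tableaux e (Suc k) \<nu>"
  defines "\<kappa> \<equiv> inner_shape (e k) \<nu> T"
  shows "restrict T (young_diagram \<kappa>) \<in> tableaux e k \<kappa>"
proof -
  have sub: "young_diagram \<kappa> \<subseteq> young_diagram \<nu>"
    unfolding \<kappa>_def by (intro young_diagram_interlacing_subset inner_shape_interlacing T)
  have left: "(i, j) \<in> young_diagram \<kappa>" if "(i, Suc j) \<in> young_diagram \<kappa>" for i j
    using that by (simp add: young_diagram_def)
  have up: "(i, j) \<in> young_diagram \<kappa>" if "(Suc i, j) \<in> young_diagram \<kappa>" for i j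
  proof -
    have \<kappa>: "\<kappa> \<in> interlacing k \<nu>"
      unfolding \<kappa>_def by (rule inner_shape_interlacing[OF T])
    have "\<kappa> (Suc i) > 0" using that by (simp add: young_diagram_def)
    then have "i < k" using \<kappa> by (cases "i < k") (auto simp: interlacing_def)
    then have "\<nu> (Suc i) \<le> \<kappa> i" using \<kappa> by (simp add: interlacing_def)
    then show ?thesis
      using that inner_shape_le[of "e k" \<nu> T "Suc i"] by (simp add: young_diagram_def \<kappa>_def)
  qed
  have "T (i, j) \<in> e ` {..<k}" if "(i, j) \<in> young_diagram \<kappa>" for i j
  proof -
    have "T (i, j) \<in> e ` {..<Suc k}"
      using T that sub by (auto simp: tableaux_def)
    moreover have "T (i, j) \<noteq> e k"
      using that by (intro entry_ne_if_less_inner_shape[of _ _ \<nu>]) (simp add: \<kappa>_def young_diagram_def)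
    ultimately show ?thesis by (auto simp: less_Suc_eq)
  qed
  then have "restrict T (young_diagram \<kappa>) \<in> young_diagram \<kappa> \<rightarrow>\<^sub>E e ` {..<k}"
    by auto
  moreover have "restrict T (young_diagram \<kappa>) (i, j) \<le> restrict T (young_diagram \<kappa>) (i, Suc j)"
    if "(i, Suc j) \<in> young_diagram \<kappa>" for i j
    using T subsetD[OF sub that] that left[OF that] by (simp add: tableaux_def)
  moreover have "restrict T (young_diagram \<kappa>) (i, j) < restrict T (young_diagram \<kappa>) (Suc i, j)"
    if "(Suc i, j) \<in> young_diagram \<kappa>" for i j
    using T subsetD[OF sub that] that up[OF that] by (simp add: tableaux_def)
  ultimately show ?thesis
    unfolding tableaux_def by blast
qed

text \<open>New letters stand only at the ends of rows, and they exceed all old ones. In a vertical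
  pair of cells the upper one always belongs to \<open>\<kappa>\<close>, by the lower interlacing
  bound, so columns remain strict.\<close>

lemma extend_tableau_mem:
  assumes \<kappa>: "\<kappa> \<in> interlacing k \<nu>" and T: "T \<in> tableaux e k \<kappa>"
  shows "extend_tableau (e k) \<nu> \<kappa> T \<in> tableaux e (Suc k) \<nu>"
proof -
  let ?T = "extend_tableau (e k) \<nu> \<kappa> T"
  note sub = young_diagram_interlacing_subset[OF \<kappa>]
  have small: "T c < e k" "T c \<in> e ` {..<k}" if "c \<in> young_diagram \<kappa>" for c
    using tableaux_entry_mem[OF T that] strict_mono_onD[OF e, of _ k] by auto
  have "?T (i, j) \<le> ?T (i, Suc j)" if "(i, Suc j) \<in> young_diagram \<nu>" for i j
  proof (cases "(i, Suc j) \<in> young_diagram \<kappa>")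
    case True
    then have "(i, j) \<in> young_diagram \<kappa>" by (simp add: young_diagram_def)
    then show ?thesis using True T by (simp add: extend_tableau_def tableaux_def)
  next
    case False
    have "(i, j) \<in> young_diagram \<nu>" using that by (simp add: young_diagram_def)
    then show ?thesis using False that small(1)[of "(i, j)"]
      by (auto simp: extend_tableau_def)
  qed
  moreover have "?T (i, j) < ?T (Suc i, j)" if "(Suc i, j) \<in> young_diagram \<nu>" for i j
  proof -
    have "i < k" using that \<nu>0[of "Suc i"] by (cases "i < k") (auto simp: young_diagram_def)
    then have "(i, j) \<in> young_diagram \<kappa>"
      using that \<kappa> by (auto simp: young_diagram_def interlacing_def intro: less_le_trans)
    then show ?thesis using that small(1)[of "(i, j)"] T
      by (auto simp: extend_tableau_def tableaux_def)
  qed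
  moreover have "?T \<in> young_diagram \<nu> \<rightarrow>\<^sub>E e ` {..<Suc k}"
  proof (rule PiE_I)
    fix c assume "c \<in> young_diagram \<nu>"
    then show "?T c \<in> e ` {..<Suc k}"
      using small(2)[of c] by (auto simp: extend_tableau_def)
  next
    fix c assume "c \<notin> young_diagram \<nu>"
    then show "?T c = undefined"
      using sub by (auto simp: extend_tableau_def)
  qed
  ultimately show ?thesis by (simp add: tableaux_def)
qed

text \<open>All entries inside \<open>\<kappa>\<close> are smaller than \<open>e k\<close>, so in
  row \<open>i\<close> the first \<open>e k\<close>, or else the end of the row, is at column
  \<open>\<kappa> i\<close>.\<close>

lemma inner_shape_extend:
  assumes \<kappa>: "\<kappa> \<in> interlacing k \<nu>" and T: "T \<in> tableaux e k \<kappa>"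
  shows "inner_shape (e k) \<nu> (extend_tableau (e k) \<nu> \<kappa> T) = \<kappa>"
proof
  fix i
  have le: "\<kappa> i \<le> \<nu> i"
    using \<kappa> by (cases "i < k") (auto simp: interlacing_def)
  have small: "T c < e k" if "c \<in> young_diagram \<kappa>" for c
    using tableaux_entry_mem[OF T that] strict_mono_onD[OF e, of _ k] by auto
  show "inner_shape (e k) \<nu> (extend_tableau (e k) \<nu> \<kappa> T) i = \<kappa> i"
    unfolding inner_shape_def
  proof (rule Least_equality)
    show "\<nu> i \<le> \<kappa> i \<or> extend_tableau (e k) \<nu> \<kappa> T (i, \<kappa> i) = e k"
      by (auto simp: extend_tableau_def young_diagram_def)
  next
    fix j assume "\<nu> i \<le> j \<or> extend_tableau (e k) \<nu> \<kappa> T (i, j) = e k"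
    then show "\<kappa> i \<le> j"
      using le small[of "(i, j)"] by (cases "j < \<kappa> i") (auto simp: extend_tableau_def young_diagram_def)
  qed
qed

text \<open>The exponent counts the cells of the strip and agrees with the one in
  \<open>alternant_Suc\<close>.\<close>

lemma weight_extend:
  fixes w :: "'a \<Rightarrow> 'b::comm_ring_1"
  assumes \<kappa>: "\<kappa> \<in> interlacing k \<nu>"
  shows "(\<Prod>c\<in>young_diagram \<nu>. w (extend_tableau (e k) \<nu> \<kappa> T c)) =
    w (e k) ^ (\<nu> k + (\<Sum>j=0..<k. \<nu> j - \<kappa> j)) * (\<Prod>c\<in>young_diagram \<kappa>. w (T c))"
proof -
  note sub = young_diagram_interlacing_subset[OF \<kappa>]
  have lt: "i < Suc k" if "j < \<nu> i" for i j
    using that \<nu>0[of i] by (cases "i < Suc k") auto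
  then have "young_diagram \<nu> = Sigma {0..<Suc k} (\<lambda>i. {..<\<nu> i})"
    by (auto simp: young_diagram_def)
  then have fin: "finite (young_diagram \<nu>)" by simp
  have "young_diagram \<nu> - young_diagram \<kappa> = Sigma {0..<Suc k} (\<lambda>i. {\<kappa> i..<\<nu> i})"
    using lt by (auto simp: young_diagram_def)
  then have "card (young_diagram \<nu> - young_diagram \<kappa>) = (\<Sum>j=0..<Suc k. \<nu> j - \<kappa> j)"
    by simp
  \<comment> \<open>Row \<open>k\<close> lies entirely in the strip, because
    \<open>\<kappa> k = 0\<close>.\<close>
  also have "\<dots> = \<nu> k + (\<Sum>j=0..<k. \<nu> j - \<kappa> j)"
    using \<kappa> by (simp add: interlacing_def)
  finally have card: "card (young_diagram \<nu> - young_diagram \<kappa>) = \<nu> k + (\<Sum>j=0..<k. \<nu> j - \<kappa> j)" .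
  have "(\<Prod>c\<in>young_diagram \<nu>. w (extend_tableau (e k) \<nu> \<kappa> T c)) =
      (\<Prod>c\<in>young_diagram \<nu> - young_diagram \<kappa>. w (extend_tableau (e k) \<nu> \<kappa> T c)) *
      (\<Prod>c\<in>young_diagram \<kappa>. w (extend_tableau (e k) \<nu> \<kappa> T c))"
    by (rule prod.subset_diff[OF sub fin])
  also have "(\<Prod>c\<in>young_diagram \<nu> - young_diagram \<kappa>. w (extend_tableau (e k) \<nu> \<kappa> T c)) =
      w (e k) ^ card (young_diagram \<nu> - young_diagram \<kappa>)"
    by (simp add: extend_tableau_def)
  also have "(\<Prod>c\<in>young_diagram \<kappa>. w (extend_tableau (e k) \<nu> \<kappa> T c)) = (\<Prod>c\<in>young_diagram \<kappa>. w (T c))"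
    by (simp add: extend_tableau_def)
  finally show ?thesis by (simp add: card)
qed

text \<open>A tableau corresponds to its inner shape together with its restriction to that shape.
  The resulting recursion is that of \<open>alternant_Suc\<close> without the product of
  differences.\<close>

lemma tableaux_sum_Suc:
  fixes w :: "'a \<Rightarrow> 'b::comm_ring_1"
  shows "tableaux_sum e w (Suc k) \<nu> = (\<Sum>\<kappa>\<in>interlacing k \<nu>.
    w (e k) ^ (\<nu> k + (\<Sum>j=0..<k. \<nu> j - \<kappa> j)) * tableaux_sum e w k \<kappa>)"
proof -
  let ?S = "Sigma (interlacing k \<nu>) (tableaux e k)"
  let ?wt = "\<lambda>\<kappa>. w (e k) ^ (\<nu> k + (\<Sum>j=0..<k. \<nu> j - \<kappa> j))"
  have fin: "finite (tableaux e k \<kappa>)" if "\<kappa> \<in> interlacing k \<nu>" for \<kappa>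
  proof (rule finite_tableaux)
    have "young_diagram \<kappa> = Sigma {0..<k} (\<lambda>i. {..<\<kappa> i})"
      using that young_diagram_interlacing by blast
    then show "finite (young_diagram \<kappa>)" by simp
  qed
  have "tableaux_sum e w (Suc k) \<nu> =
      (\<Sum>(\<kappa>, T)\<in>?S. ?wt \<kappa> * (\<Prod>c\<in>young_diagram \<kappa>. w (T c)))"
    unfolding tableaux_sum_def
  proof (rule sum.reindex_bij_witness[where
        i = "\<lambda>(\<kappa>, T). extend_tableau (e k) \<nu> \<kappa> T" and
        j = "\<lambda>T. (inner_shape (e k) \<nu> T, restrict T (young_diagram (inner_shape (e k) \<nu> T)))"])
    fix T assume T: "T \<in> tableaux e (Suc k) \<nu>"
    let ?\<kappa> = "inner_shape (e k) \<nu> T"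
    have \<kappa>: "?\<kappa> \<in> interlacing k \<nu>" using T by (rule inner_shape_interlacing)
    have *: "extend_tableau (e k) \<nu> ?\<kappa> (restrict T (young_diagram ?\<kappa>)) = T"
    proof
      fix c :: "nat \<times> nat"
      obtain i j where c: "c = (i, j)" by fastforce
      show "extend_tableau (e k) \<nu> ?\<kappa> (restrict T (young_diagram ?\<kappa>)) c = T c"
      proof (cases "c \<in> young_diagram \<nu>")
        case True
        then show ?thesis using entry_eq_last_iff[OF T, of j i]
          by (auto simp: extend_tableau_def c young_diagram_def not_less)
      next
        case False
        then have "T c = undefined" using T by (auto simp: tableaux_def intro: PiE_arb)
        then show ?thesis using False by (auto simp: extend_tableau_def)
      qed
    qed
    then show "(case (?\<kappa>, restrict T (young_diagram ?\<kappa>)) of (\<kappa>, T) \<Rightarrow> extend_tableau (e k) \<nu> \<kappa> T) = T"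
      by simp
    show "(?\<kappa>, restrict T (young_diagram ?\<kappa>)) \<in> ?S"
      using \<kappa> restrict_tableau[OF T] by simp
    show "(case (?\<kappa>, restrict T (young_diagram ?\<kappa>)) of
        (\<kappa>, T) \<Rightarrow> ?wt \<kappa> * (\<Prod>c\<in>young_diagram \<kappa>. w (T c))) = (\<Prod>c\<in>young_diagram \<nu>. w (T c))"
      using weight_extend[OF \<kappa>, of w "restrict T (young_diagram ?\<kappa>)"] by (simp add: *)
  next
    fix b assume "b \<in> ?S"
    then obtain \<kappa> T where b: "b = (\<kappa>, T)" and \<kappa>: "\<kappa> \<in> interlacing k \<nu>" and T: "T \<in> tableaux e k \<kappa>"
      by auto
    show "(case b of (\<kappa>, T) \<Rightarrow> extend_tableau (e k) \<nu> \<kappa> T) \<in> tableaux e (Suc k) \<nu>"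
      using extend_tableau_mem[OF \<kappa> T] by (simp add: b)
    have "restrict (extend_tableau (e k) \<nu> \<kappa> T) (young_diagram \<kappa>) = T"
      using T by (auto simp: fun_eq_iff extend_tableau_def tableaux_def restrict_def PiE_iff extensional_def)
    then show "(inner_shape (e k) \<nu> (case b of (\<kappa>, T) \<Rightarrow> extend_tableau (e k) \<nu> \<kappa> T),
        restrict (case b of (\<kappa>, T) \<Rightarrow> extend_tableau (e k) \<nu> \<kappa> T) (young_diagram
          (inner_shape (e k) \<nu> (case b of (\<kappa>, T) \<Rightarrow> extend_tableau (e k) \<nu> \<kappa> T)))) = b"
      using inner_shape_extend[OF \<kappa> T] by (simp add: b)
  qed
  also have "\<dots> = (\<Sum>\<kappa>\<in>interlacing k \<nu>. \<Sum>T\<in>tableaux e k \<kappa>. ?wt \<kappa> * (\<Prod>c\<in>young_diagram \<kappa>. w (T c)))"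
    using fin by (subst sum.Sigma) (auto simp: finite_interlacing)
  finally show ?thesis
    by (simp add: tableaux_sum_def sum_distrib_left)
qed

end

section \<open>The bialternant formula\<close>

text \<open>Stated without division, so that it makes sense in any commutative ring. The product of
  differences by which the two branching rules disagree is exactly the factor gained by the
  Vandermonde determinant in \<open>alternant_0_Suc\<close>.\<close>

lemma tableaux_sum_times_alternant_0:
  fixes e :: "nat \<Rightarrow> 'a::linorder" and w :: "'a \<Rightarrow> 'b::comm_ring_1"
  assumes "strict_mono_on {..<k} e" "antimono \<nu>" "\<And>i. i \<ge> k \<Longrightarrow> \<nu> i = 0"
  shows "tableaux_sum e w k \<nu> * alternant (\<lambda>i. w (e i)) k (\<lambda>_. 0) = alternant (\<lambda>i. w (e i)) k \<nu>"
  using assms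
proof (induction k arbitrary: \<nu>)
  case 0
  then have "young_diagram \<nu> = {}" by (simp add: young_diagram_def)
  then have "tableaux_sum e w 0 \<nu> = 1"
    by (simp add: tableaux_sum_def tableaux_def)
  then show ?case by (simp add: alternant_def)
next
  case (Suc k)
  let ?x = "\<lambda>i. w (e i)"
  let ?P = "\<Prod>i=0..<k. ?x i - ?x k"
  let ?wt = "\<lambda>\<kappa>. ?x k ^ (\<nu> k + (\<Sum>j=0..<k. \<nu> j - \<kappa> j))"
  have IH: "tableaux_sum e w k \<kappa> * alternant ?x k (\<lambda>_. 0) = alternant ?x k \<kappa>"
    if "\<kappa> \<in> interlacing k \<nu>" for \<kappa>
  proof (rule Suc.IH)
    show "strict_mono_on {..<k} e"
      using Suc.prems(1) by (auto simp: strict_mono_on_def)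
    show "antimono \<kappa>" using that by (rule antimono_interlacing)
    show "\<kappa> i = 0" if "i \<ge> k" for i
      using \<open>\<kappa> \<in> interlacing k \<nu>\<close> that by (simp add: interlacing_def)
  qed
  have "tableaux_sum e w (Suc k) \<nu> * alternant ?x (Suc k) (\<lambda>_. 0)
      = (\<Sum>\<kappa>\<in>interlacing k \<nu>. ?wt \<kappa> * tableaux_sum e w k \<kappa>) * (?P * alternant ?x k (\<lambda>_. 0))"
    using Suc.prems by (subst tableaux_sum_Suc) (auto simp: alternant_0_Suc)
  also have "\<dots> = ?P * (\<Sum>\<kappa>\<in>interlacing k \<nu>. ?wt \<kappa> * (tableaux_sum e w k \<kappa> * alternant ?x k (\<lambda>_. 0)))"
    by (simp add: sum_distrib_left sum_distrib_right mult_ac)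
  also have "\<dots> = ?P * (\<Sum>\<kappa>\<in>interlacing k \<nu>. ?wt \<kappa> * alternant ?x k \<kappa>)"
    using IH by simp
  also have "\<dots> = alternant ?x (Suc k) \<nu>"
    using antimonoD[OF Suc.prems(2)] by (intro alternant_Suc[symmetric]) auto
  finally show ?case .
qed

section \<open>Passage to Schur polynomials and linear recurrences\<close>

lemma ssyt_eq_tableaux:
  assumes "e ` {..<k} = (UNIV :: 'n::{finite,linorder} set)"
  shows "ssyt \<nu> = tableaux e k \<nu>"
  by (simp add: ssyt_def tableaux_def assms)

lemma to_fract_prod: "to_fract (\<Prod>x\<in>A. f x) = (\<Prod>x\<in>A. to_fract (f x))"
  by (induction A rule: infinite_finite_induct) auto

lemma inj_var: "inj (var :: 'n::{finite,linorder} \<Rightarrow> 'n mpolyn)"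
proof (rule injI)
  fix i j :: 'n
  assume "var i = var j"
  then have "Poly_Mapping.single i (1::nat) = Poly_Mapping.single j 1"
    unfolding var_def by (metis lookup_single_eq lookup_single_not_eq zero_neq_one)
  then show "i = j"
    by (metis lookup_single_eq lookup_single_not_eq zero_neq_one)
qed

text \<open>The enumeration must preserve the order, because the tableau conditions compare
  letters.\<close>

lemma ex_enumeration:
  "\<exists>e :: nat \<Rightarrow> 'n::{finite,linorder}. strict_mono_on {..<CARD('n)} e \<and> e ` {..<CARD('n)} = UNIV"
proof -
  let ?xs = "sorted_list_of_set (UNIV :: 'n set)"
  have len: "length ?xs = CARD('n)" by simp
  have "strict_mono_on {..<CARD('n)} ((!) ?xs)"
    using sorted_wrt_nth_less[OF strict_sorted_list_of_set[of "UNIV :: 'n set"]]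
    by (intro strict_mono_onI) (auto simp: len)
  moreover have "(!) ?xs ` {..<CARD('n)} = set ?xs"
    by (auto simp: set_conv_nth len)
  ultimately show ?thesis by auto
qed

text \<open>Applied to the term \<open>c p * y p ^ l\<close>, the recurrence at \<open>k\<close>
  gives \<open>c p * y p ^ k * poly Q (y p)\<close>, which vanishes. The denominator
  \<open>d\<close> does not depend on \<open>l\<close> and cancels.\<close>

lemma recurrence_at_exponential_sum:
  fixes Q :: "'a::field poly"
  assumes "lead_coeff Q = 1" "d \<noteq> 0"
    and f: "\<And>l. f l * d = (\<Sum>p\<in>P. c p * y p ^ l)"
    and root: "\<And>p. p \<in> P \<Longrightarrow> poly Q (y p) = 0"
  shows "recurrence_at Q f k"
proof -
  have "(\<Sum>i\<le>degree Q. coeff Q i * f (k + i)) * d = (\<Sum>i\<le>degree Q. coeff Q i * (f (k + i) * d))"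
    by (simp add: sum_distrib_right mult.assoc)
  also have "\<dots> = (\<Sum>i\<le>degree Q. \<Sum>p\<in>P. c p * y p ^ k * (coeff Q i * y p ^ i))"
    unfolding f by (simp add: sum_distrib_left power_add mult_ac)
  also have "\<dots> = (\<Sum>p\<in>P. c p * y p ^ k * poly Q (y p))"
    by (subst sum.swap) (simp add: poly_altdef sum_distrib_left)
  also have "\<dots> = 0"
    by (simp add: root)
  finally show ?thesis
    using assms(1,2) by (simp add: recurrence_at_def)
qed

text \<open>A nonzero part at index \<open>i\<close> forces all \<open>i + 1\<close> parts up to
  that index to be nonzero.\<close>

lemma partition_parts_zero:
  assumes "is_partition \<nu>" "num_parts \<nu> \<le> r" "r \<le> i"
  shows "\<nu> i = 0"
proof (rule ccontr)
  assume "\<nu> i \<noteq> 0"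
  then have "{..i} \<subseteq> {j. \<nu> j \<noteq> 0}"
    using assms(1) by (auto simp: is_partition_def dest!: antimonoD[of \<nu> _ i])
  then have "Suc i \<le> num_parts \<nu>"
    using assms(1) card_mono[of "{j. \<nu> j \<noteq> 0}" "{..i}"] by (simp add: num_parts_def is_partition_def)
  then show False using assms by simp
qed

theorem theorem5p1:
  fixes m r :: nat
    and lam \<mu> :: "nat \<Rightarrow> nat"
    and f :: "nat \<Rightarrow> 'n::{finite,linorder} ratfun"
    and Q :: "'n ratfun poly"
  assumes "m \<ge> 1"
    and "1 \<le> r" and "r \<le> CARD('n)"
    and "is_partition lam" and "num_parts lam \<le> r"
    and "\<mu> = rect_partition r m"
    and "f = (\<lambda>l. to_fract (schur (\<lambda>i. lam i + l * \<mu> i)))"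
    and "Q = (\<Prod>I\<in>{I :: 'n set. card I = r}. [:- ((\<Prod>i\<in>I. to_fract (var i)) ^ m), 1:])"
  shows "\<forall>\<^sub>\<infinity>l. recurrence_at Q f l"
proof -
  let ?n = "CARD('n)"
  let ?w = "\<lambda>i::'n. to_fract (var i)"
  obtain e :: "nat \<Rightarrow> 'n" where mono: "strict_mono_on {..<?n} e" and surj: "e ` {..<?n} = UNIV"
    using ex_enumeration by blast
  have inj: "inj_on e {..<?n}"
    using mono by (rule strict_mono_on_imp_inj_on)
  let ?x = "\<lambda>i. ?w (e i)"
  let ?d = "alternant ?x ?n (\<lambda>_. 0)"
  let ?P = "{p. p permutes {0..<?n}}"
  \<comment> \<open>In the term of the alternant for \<open>p\<close>, the exponent
    \<open>lam j + l * \<mu> j + (?n - 1 - j)\<close> splits: the part free of \<open>l\<close> goes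
    into \<open>c p\<close>, and the rest is the \<open>l\<close>-th power of
    \<open>y p\<close>.\<close>
  define c where "c p = signof p * (\<Prod>j=0..<?n. ?x (p j) ^ (lam j + (?n - 1 - j)))" for p
  define y where "y p = (\<Prod>j=0..<?n. ?x (p j) ^ \<mu> j)" for p
  have "inj_on ?x {..<?n}"
    using inj inj_var by (auto simp: inj_on_def inj_def)
  then have "?d \<noteq> 0" by (rule alternant_0_nonzero)
  have lead: "lead_coeff Q = 1"
    unfolding assms(8) by (simp add: lead_coeff_prod)
  have f: "f l * ?d = (\<Sum>p\<in>?P. c p * y p ^ l)" for l
  proof -
    let ?\<nu> = "\<lambda>i. lam i + l * \<mu> i"
    have "antimono ?\<nu>"
      using assms(4,6) by (intro antimonoI add_mono mult_le_mono2)
        (auto simp: is_partition_def rect_partition_def dest: antimonoD)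
    moreover have "?\<nu> i = 0" if "i \<ge> ?n" for i
      using partition_parts_zero[OF assms(4,5), of i] that assms(3,6) by (simp add: rect_partition_def)
    ultimately have "tableaux_sum e ?w ?n ?\<nu> * ?d = alternant ?x ?n ?\<nu>"
      by (intro tableaux_sum_times_alternant_0 mono)
    moreover have "f l = tableaux_sum e ?w ?n ?\<nu>"
      by (simp add: assms(7) schur_def tableaux_sum_def to_fract_prod ssyt_eq_tableaux[OF surj])
    moreover have "alternant ?x ?n ?\<nu> = (\<Sum>p\<in>?P. c p * y p ^ l)"
      unfolding alternant_expand c_def y_def prod_power_distrib mult.assoc prod.distrib[symmetric]
        power_mult[symmetric] power_add[symmetric]
      by (intro sum.cong prod.cong arg_cong2[where f = "(*)"] arg_cong2[where f = "(^)"] refl)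
        (simp add: mult.commute)
    ultimately show ?thesis by simp
  qed
  have root: "poly Q (y p) = 0" if "p \<in> ?P" for p
  proof -
    \<comment> \<open>The letters that \<open>p\<close> assigns to the first \<open>r\<close> parts.
      The factor of \<open>Q\<close> for this set is the one that vanishes at
      \<open>y p\<close>.\<close>
    let ?I = "(e \<circ> p) ` {0..<r}"
    have p: "p permutes {0..<?n}" using that by simp
    have inj_ep: "inj_on (e \<circ> p) {0..<r}"
    proof (rule comp_inj_on)
      show "inj_on p {0..<r}" by (rule permutes_inj_on[OF p])
      have "p ` {0..<r} \<subseteq> {..<?n}"
        using permutes_image[OF p] assms(3) by fastforce
      then show "inj_on e (p ` {0..<r})" by (rule inj_on_subset[OF inj])
    qed
    \<comment> \<open>Positions from \<open>r\<close> on have exponent \<open>\<mu> j = 0\<close>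
      and contribute 1.\<close>
    have "y p = (\<Prod>j=0..<r. ?x (p j) ^ m)"
      unfolding y_def assms(6) using assms(3)
      by (intro prod.mono_neutral_cong_right) (auto simp: rect_partition_def)
    also have "\<dots> = (\<Prod>i\<in>?I. ?w i) ^ m"
      unfolding prod.reindex[OF inj_ep] by (simp add: prod_power_distrib)
    finally have "poly [:- ((\<Prod>i\<in>?I. ?w i) ^ m), 1:] (y p) = 0" by simp
    moreover have "?I \<in> {I. card I = r}"
      unfolding mem_Collect_eq card_image[OF inj_ep] by simp
    ultimately show ?thesis
      unfolding assms(8) poly_prod by (intro prod_zero bexI[of _ ?I] finite)
  qed
  show ?thesis
    by (intro ALL_MOST allI recurrence_at_exponential_sum[OF lead \<open>?d \<noteq> 0\<close> f root])
qed

end
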